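(* Let $n>2$ be an integer, let $r$ be a Golay number, and let $k_1,k_2,\dots,k_{2^{n-3}-1}$ be complex Golay numbers (for $n=3$ this list is empty). Put $m=2\sum_{j=1}^{2^{n-3}-1}k_j+r+1$ and $q=2^{n-1}+n-1$. Then there exists a complex orthogonal design $$COD\Big(2^q m;\ 2^q,\ 2^q r,\ 2^{q+1}k_1,\ \dots,\ 2^{q+1}k_{2^{n-3}-1}\Big).$$
   Context: For a sequence $A=(a_1,\dots,a_n)$ of complex numbers, its non-periodic autocorrelation function is $N_A(j)=\sum_{i=1}^{n-j}a_{i+j}\overline{a_i}$ for $0\le j\le n-1$ and $N_A(j)=0$ for $j\ge n$. A Golay pair of length $n$ is a pair $(A;B)$ of sequences of length $n$ with entries in $\{\pm1\}$ such that $N_A(j)+N_B(j)=0$ for all $j>0$; a Golay number is a positive integer $n$ for which a Golay pair of length $n$ exists. A complex Golay pair of length $n$ is a pair of sequences of length $n$ with entries in $\{\pm1,\pm i\}$ with the same property, and a complex Golay number is a positive integer for which a complex Golay pair of that length exists. A complex orthogonal design $COD(N;\,c_1,\dots,c_k)$ is an $N\times N$ matrix $X$ with entries from $\{0,\pm x_1,\pm ix_1,\dots,\pm x_k,\pm ix_k\}$ ($x_j$ commuting real variables) satisfying $XX^*=\big(\sum_{j=1}^k c_jx_j^2\big)I_N$ with positive integers $c_j$, where $*$ denotes conjugate transpose. *)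

theory Defs
  imports Complex_Main "HOL-Library.Poly_Mapping" "Jordan_Normal_Form.Matrix"
begin

text \<open>A sequence $(a_1,\dots,a_n)$ is a list, so $a_i$ is \<open>A ! (i - 1)\<close>. For \<open>j \<ge> length A\<close> the
  truncated subtraction makes the sum empty, as required.\<close>

definition autocorr :: "complex list \<Rightarrow> nat \<Rightarrow> complex" where
  "autocorr A j = (\<Sum>i<length A - j. A ! (i + j) * cnj (A ! i))"

definition complementary :: "complex list \<Rightarrow> complex list \<Rightarrow> bool" where
  "complementary A B \<longleftrightarrow> (\<forall>j>0. autocorr A j + autocorr B j = 0)"

definition golay_pair :: "nat \<Rightarrow> complex list \<Rightarrow> complex list \<Rightarrow> bool" where
  "golay_pair n A B \<longleftrightarrow> length A = n \<and> length B = n \<and>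
     set A \<subseteq> {1, -1} \<and> set B \<subseteq> {1, -1} \<and> complementary A B"

definition golay_number :: "nat \<Rightarrow> bool" where
  "golay_number n \<longleftrightarrow> n > 0 \<and> (\<exists>A B. golay_pair n A B)"

definition complex_golay_pair :: "nat \<Rightarrow> complex list \<Rightarrow> complex list \<Rightarrow> bool" where
  "complex_golay_pair n A B \<longleftrightarrow> length A = n \<and> length B = n \<and>
     set A \<subseteq> {1, -1, \<i>, -\<i>} \<and> set B \<subseteq> {1, -1, \<i>, -\<i>} \<and> complementary A B"

definition complex_golay_number :: "nat \<Rightarrow> bool" where
  "complex_golay_number n \<longleftrightarrow> n > 0 \<and> (\<exists>A B. complex_golay_pair n A B)"

text \<open>Polynomials with complex coefficients in the commuting variables $x_0, x_1, \dots$: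
  a power product is a finitely supported map from variable indices to exponents.\<close>

type_synonym cpoly = "(nat \<Rightarrow>\<^sub>0 nat) \<Rightarrow>\<^sub>0 complex"

definition cterm :: "complex \<Rightarrow> nat \<Rightarrow> cpoly" where
  "cterm u j = Poly_Mapping.single (Poly_Mapping.single j 1) u"

abbreviation var :: "nat \<Rightarrow> cpoly" where
  "var j \<equiv> cterm 1 j"

text \<open>The variables are real, so conjugation fixes them and acts on the coefficients only.\<close>

definition conj_transpose :: "cpoly mat \<Rightarrow> cpoly mat" where
  "conj_transpose X = transpose_mat (map_mat (Poly_Mapping.map cnj) X)"

text \<open>The list \<open>cs\<close> holds $c_1,\dots,c_k$; the variable belonging to \<open>cs ! j\<close> is \<open>var j\<close>.\<close>

definition is_COD :: "nat \<Rightarrow> nat list \<Rightarrow> cpoly mat \<Rightarrow> bool" where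
  "is_COD N cs X \<longleftrightarrow> X \<in> carrier_mat N N \<and>
     (\<forall>c\<in>set cs. c > 0) \<and>
     elements_mat X \<subseteq> {0} \<union> {cterm u j | u j. u \<in> {1, -1, \<i>, -\<i>} \<and> j < length cs} \<and>
     X * conj_transpose X = (\<Sum>j<length cs. of_nat (cs ! j) * (var j)\<^sup>2) \<cdot>\<^sub>m 1\<^sub>m N"

end

theory Submission imports Defs begin

text \<open>
  Split the \<open>m\<close> positions into \<open>2\<^sup>e\<close> blocks, \<open>e = n - 2\<close>: one of length 1 for the first variable, one of
  length \<open>r\<close> for the second, and two of length \<open>k\<^sub>j\<close> for each further variable; let \<open>(A\<^sub>v; B\<^sub>v)\<close> be a
  complex Golay pair of the length of block \<open>v\<close>, scaled by its variable. With a Sylvester matrix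
  \<open>H\<close>, the \<open>p = 2\<^bsup>n-1\<^esup>\<close> sequences obtained by concatenating the \<open>H\<^sub>h\<^sub>v A\<^sub>v\<close>, respectively the
  \<open>H\<^sub>h\<^sub>v B\<^sub>v\<close>, are complementary of length \<open>m\<close>: the cross terms of distinct blocks cancel by
  orthogonality of the columns of \<open>H\<close>.

  Let \<open>X\<^sub>c\<close>, \<open>c < p\<close>, be the circulant matrices of these sequences; they commute. On the
  \<open>2\<^sup>p\<close> subsets \<open>S\<close> of \<open>{..<p}\<close> let \<open>D\<^sub>c\<close> toggle \<open>c\<close> with coefficient \<open>X\<^sub>c\<close> or \<open>X\<^sub>c\<^sup>*\<close> according to
  whether \<open>c \<notin> S\<close> or \<open>c \<in> S\<close>, and with the Jordan--Wigner sign given by the number of elements of \<open>S\<close> below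
  \<open>c\<close>. The \<open>D\<^sub>c\<close> are Hermitian, they anticommute, and the sum of their squares is scalar, so the
  \<open>p \<times> p\<close> block matrix with \<open>(a, b)\<close> block \<open>D\<close> indexed by \<open>a XOR b\<close> has orthogonal rows: off the
  diagonal the terms of \<open>b\<close> and of \<open>b XOR a XOR a'\<close> cancel. Multiplying each block on the right by the
  Sylvester matrix of order \<open>2\<^sup>p\<close> fills all zeros, since each \<open>D\<^sub>c\<close> is monomial in \<open>S\<close>.
\<close>

section \<open>Cyclic sums, characters of subsets and Sylvester matrices\<close>

lemma sum_mod_shift:
  fixes M a :: int
  assumes "M > 0"
  shows "(\<Sum>u\<in>{0..<M}. f ((u + a) mod M)) = (\<Sum>u\<in>{0..<M}. f u)"
  by (rule sum.reindex_bij_witness[where i = "\<lambda>u. (u - a) mod M" and j = "\<lambda>u. (u + a) mod M"])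
    (use assms in \<open>auto simp: mod_simps\<close>)

lemma sum_mod_reflect:
  fixes M a :: int
  assumes "M > 0"
  shows "(\<Sum>u\<in>{0..<M}. f ((a - u) mod M)) = (\<Sum>u\<in>{0..<M}. f u)"
  by (rule sum.reindex_bij_witness[where i = "\<lambda>u. (a - u) mod M" and j = "\<lambda>u. (a - u) mod M"])
    (use assms in \<open>auto simp: mod_simps\<close>)

lemma power_minus_one_card_Int:
  assumes "finite U"
  shows "(-1 :: 'a :: comm_ring_1) ^ card (S \<inter> U) = (\<Prod>x\<in>U. if x \<in> S then -1 else 1)"
proof -
  have "(\<Prod>x\<in>U. if x \<in> S then -1 else (1 :: 'a)) = (\<Prod>x\<in>U \<inter> S. -1)"
    by (rule prod.inter_restrict[OF assms, symmetric])
  then show ?thesis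
    by (simp add: Int_commute)
qed

text \<open>The product of the two signs is multiplicative in \<open>U\<close>, so the sum factors
  as the product of \<open>g x + 1\<close>; an element of exactly one of \<open>S\<close> and
  \<open>T\<close> gives a zero factor.\<close>

lemma sum_Pow_characters:
  assumes "finite A" "S \<subseteq> A" "T \<subseteq> A"
  shows "(\<Sum>U\<in>Pow A. (-1) ^ card (S \<inter> U) * (-1) ^ card (T \<inter> U)) =
    (if S = T then 2 ^ card A else (0 :: 'a :: comm_ring_1))"
proof -
  define g where "g x = (if x \<in> S then -1 else 1) * (if x \<in> T then -1 else (1 :: 'a))" for x
  have "(\<Sum>U\<in>Pow A. (-1) ^ card (S \<inter> U) * (-1) ^ card (T \<inter> U)) = (\<Sum>U\<in>Pow A. \<Prod>x\<in>U. g x)"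
    using assms(1)
    by (intro sum.cong) (auto simp: power_minus_one_card_Int finite_subset g_def prod.distrib)
  also have "\<dots> = (\<Prod>x\<in>A. g x + 1)"
    using assms(1) by (subst prod_add) simp_all
  also have "\<dots> = (if S = T then 2 ^ card A else 0)"
  proof (cases "S = T")
    case True
    then have "g x + 1 = 2" for x
      by (simp add: g_def)
    with True show ?thesis by simp
  next
    case False
    with assms obtain x where "x \<in> A" "x \<in> S \<longleftrightarrow> x \<notin> T" by blast
    then have "x \<in> A" "g x + 1 = 0"
      by (auto simp: g_def)
    with False assms(1) show ?thesis by (auto intro: prod_zero)
  qed
  finally show ?thesis .
qed

text \<open>These signs form a Sylvester matrix: an arbitrary bijection labels rows and columns by
  subsets of \<open>{..<e}\<close>, and orthogonality is that of the characters.\<close>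

lemma exists_hadamard_signs:
  "\<exists>H :: nat \<Rightarrow> nat \<Rightarrow> complex. (\<forall>h v. H h v \<in> {1, -1}) \<and>
     (\<forall>v<2 ^ e. \<forall>w<2 ^ e. (\<Sum>h<2 ^ e. H h v * H h w) = (if v = w then 2 ^ e else 0))"
proof -
  have "card {..<2 ^ e :: nat} = card (Pow {..<e})"
    by (simp add: card_Pow)
  then obtain b where b: "bij_betw b {..<2 ^ e :: nat} (Pow {..<e})"
    by (metis finite_Pow_iff finite_lessThan finite_same_card_bij)
  define H :: "nat \<Rightarrow> nat \<Rightarrow> complex" where "H h v = (-1) ^ card (b v \<inter> b h)" for h v
  have "(\<Sum>h<2 ^ e. H h v * H h w) = (if v = w then 2 ^ e else 0)"
    if "v < 2 ^ e" "w < 2 ^ e" for v w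
  proof -
    have "(\<Sum>h<2 ^ e. H h v * H h w) =
        (\<Sum>U\<in>Pow {..<e}. (-1) ^ card (b v \<inter> U) * (-1) ^ card (b w \<inter> U))"
      unfolding H_def by (rule sum.reindex_bij_betw[OF b])
    also have "\<dots> = (if b v = b w then 2 ^ e else 0)"
      using that bij_betwE[OF b] by (subst sum_Pow_characters) auto
    also have "b v = b w \<longleftrightarrow> v = w"
      using that bij_betw_imp_inj_on[OF b] by (auto simp: inj_on_def)
    finally show ?thesis .
  qed
  moreover have "H h v \<in> {1, -1}" for h v
    by (simp add: H_def minus_one_power_iff)
  ultimately show ?thesis by blast
qed

section \<open>Toggling elements of a set and Jordan-Wigner signs\<close>

definition toggle :: "'b \<Rightarrow> 'b set \<Rightarrow> 'b set" where
  "toggle c S = (if c \<in> S then S - {c} else insert c S)"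

lemma toggle_toggle [simp]: "toggle c (toggle c S) = S"
  by (auto simp: toggle_def)

lemma toggle_eq_iff [simp]: "toggle c S = toggle c T \<longleftrightarrow> S = T"
  by (metis toggle_toggle)

lemma toggle_commute: "toggle c (toggle d S) = toggle d (toggle c S)"
  by (auto simp: toggle_def)

lemma mem_toggle: "x \<in> toggle c S \<longleftrightarrow> (x \<in> S) \<noteq> (x = c)"
  by (auto simp: toggle_def)

lemma toggle_subset: "c \<in> A \<Longrightarrow> S \<subseteq> A \<Longrightarrow> toggle c S \<subseteq> A"
  by (auto simp: toggle_def)

definition below_sign :: "nat \<Rightarrow> nat set \<Rightarrow> 'a :: comm_ring_1" where
  "below_sign c S = (-1) ^ card (S \<inter> {..<c})"

lemma below_sign_square [simp]: "below_sign c S * below_sign c S = 1"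
  by (simp add: below_sign_def flip: power_add)

text \<open>Toggling \<open>d\<close> flips one factor of the product over the positions below
  \<open>c\<close>, and none if \<open>d \<ge> c\<close>. Of two distinct indices exactly one lies
  below the other, which makes the signed toggles anticommute.\<close>

lemma below_sign_toggle:
  "below_sign c (toggle d S) = (if d < c then - below_sign c S else below_sign c S)"
proof -
  have *: "below_sign c T = (\<Prod>x<c. if x \<in> T then -1 else 1)" for T
    by (simp add: below_sign_def power_minus_one_card_Int)
  show ?thesis
  proof (cases "d < c")
    case True
    then have "{..<c} = insert d ({..<c} - {d})" by auto
    moreover have "(\<Prod>x\<in>{..<c} - {d}. if x \<in> toggle d S then -1 else (1 :: 'a)) =
        (\<Prod>x\<in>{..<c} - {d}. if x \<in> S then -1 else 1)"
      by (intro prod.cong) (auto simp: mem_toggle)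
    ultimately show ?thesis
      using True unfolding * by (simp add: prod.remove[of "{..<c}" d] mem_toggle del: toggle_toggle)
  next
    case False
    then show ?thesis unfolding * by (auto simp: mem_toggle intro!: prod.cong)
  qed
qed

section \<open>The block design and the orthogonality of its rows\<close>

lemma xor_less_power2:
  fixes a b :: nat
  assumes "a < 2 ^ e" "b < 2 ^ e"
  shows "xor a b < 2 ^ e"
proof -
  have "take_bit e (xor a b) = xor a b"
    using assms by (simp add: take_bit_xor take_bit_nat_eq_self)
  then show ?thesis by (metis take_bit_nat_less_exp)
qed

lemma xor_cancel_left [simp]: "xor a (xor a b) = (b :: nat)"
  by (simp flip: xor.assoc)

lemma xor_left_eq_iff: "xor a b = xor a' b \<longleftrightarrow> a = (a' :: nat)"
  by (metis xor.commute xor_cancel_left)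

text \<open>\<open>X'\<close> stands for the entrywise conjugate of \<open>X\<close>; keeping it a separate parameter means that no
  involution on the coefficient ring is needed, and swapping the two parameters conjugates an entry.\<close>

definition design_entry ::
  "int \<Rightarrow> (nat \<Rightarrow> int \<Rightarrow> 'a) \<Rightarrow> (nat \<Rightarrow> int \<Rightarrow> 'a) \<Rightarrow> nat \<times> nat set \<times> int \<Rightarrow> nat \<times> nat set \<times> int \<Rightarrow>
    'a :: comm_ring_1" where
  "design_entry M X X' = (\<lambda>(a, S, t) (b, U, u).
     below_sign (xor a b) S * (-1) ^ card (toggle (xor a b) S \<inter> U) *
     (if xor a b \<in> S then X' (xor a b) ((t - u) mod M) else X (xor a b) ((u - t) mod M)))"

text \<open>The components are block number, subset and position in a circulant. In a row the subset
  is what the toggles act on; in a column it labels a column of the Sylvester matrix.\<close>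

definition design_index :: "nat \<Rightarrow> int \<Rightarrow> (nat \<times> nat set \<times> int) set" where
  "design_index e M = {..<2 ^ e} \<times> Pow {..<2 ^ e} \<times> {0..<M}"

lemma card_design_index: "M \<ge> 0 \<Longrightarrow> card (design_index e M) = 2 ^ (2 ^ e + e) * nat M"
  by (simp add: design_index_def card_cartesian_product card_Pow power_add)

lemma finite_design_index: "finite (design_index e M)"
  by (simp add: design_index_def)

text \<open>Summing over the Sylvester columns leaves only toggles that reach the same subset. For
  different block rows these cancel in pairs by anticommutation; within one block row the periodic
  correlation in \<open>compl\<close> remains.\<close>

lemma design_rows_orthogonal:
  fixes X X' :: "nat \<Rightarrow> int \<Rightarrow> 'a :: {idom, ring_char_0}"
  assumes M: "M > 0"
    and compl: "\<And>s. (\<Sum>c<2 ^ e. \<Sum>w\<in>{0..<M}. X c ((w + s) mod M) * X' c w) =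
      (if s mod M = 0 then f else 0)"
    and p: "p \<in> design_index e M" and p': "p' \<in> design_index e M"
  shows "(\<Sum>z\<in>design_index e M. design_entry M X X' p z * design_entry M X' X p' z) =
    (if p = p' then 2 ^ 2 ^ e * f else 0)"
proof -
  obtain a S t where p_eq: "p = (a, S, t)" by (cases p)
  obtain a' S' t' where p'_eq: "p' = (a', S', t')" by (cases p')
  have mem: "a < 2 ^ e" "S \<subseteq> {..<2 ^ e}" "0 \<le> t" "t < M"
      "a' < 2 ^ e" "S' \<subseteq> {..<2 ^ e}" "0 \<le> t'" "t' < M"
    using p p' by (auto simp: p_eq p'_eq design_index_def)
  \<comment> \<open>As functions of column minus row, \<open>Y\<close> gives the circulant of
    \<open>X c\<close> or its conjugate transpose, according to whether \<open>c \<in> T\<close>;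
    \<open>Y'\<close> gives the entrywise conjugate.\<close>
  define Y where "Y c T x = (if c \<in> T then X' c ((- x) mod M) else X c (x mod M))" for c T x
  define Y' where "Y' c T x = (if c \<in> T then X c ((- x) mod M) else X' c (x mod M))" for c T x
  define G where "G c c' = (\<Sum>u\<in>{0..<M}. Y c S (u - t) * Y' c' S' (u - t'))" for c c'
  \<comment> \<open>What one block column contributes once the sum over \<open>U\<close> is
    evaluated; \<open>c\<close> and \<open>c'\<close> are its labels in the two rows.\<close>
  define E where "E c c' = below_sign c S * below_sign c' S' *
      (if toggle c S = toggle c' S' then 2 ^ 2 ^ e else 0) * G c c'" for c c'
  have "(\<Sum>z\<in>design_index e M. design_entry M X X' p z * design_entry M X' X p' z) =
      (\<Sum>b<2 ^ e. \<Sum>U\<in>Pow {..<2 ^ e}. \<Sum>u\<in>{0..<M}.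
        below_sign (xor a b) S * below_sign (xor a' b) S' *
        (((-1) ^ card (toggle (xor a b) S \<inter> U) * (-1) ^ card (toggle (xor a' b) S' \<inter> U)) *
        (Y (xor a b) S (u - t) * Y' (xor a' b) S' (u - t'))))"
    unfolding design_index_def sum.cartesian_product' p_eq p'_eq design_entry_def
      Y_def Y'_def
    by (intro sum.cong) (simp_all add: algebra_simps)
  also have "\<dots> = (\<Sum>b<2 ^ e. below_sign (xor a b) S * below_sign (xor a' b) S' *
      ((\<Sum>U\<in>Pow {..<2 ^ e}. (-1) ^ card (toggle (xor a b) S \<inter> U) *
        (-1) ^ card (toggle (xor a' b) S' \<inter> U)) * G (xor a b) (xor a' b)))"
    unfolding G_def sum_product by (simp add: sum_distrib_left)
  also have "\<dots> = (\<Sum>b<2 ^ e. E (xor a b) (xor a' b))"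
    using mem by (intro sum.cong refl, subst sum_Pow_characters)
      (simp_all add: E_def toggle_subset xor_less_power2)
  finally have total: "(\<Sum>z\<in>design_index e M. design_entry M X X' p z * design_entry M X' X p' z) =
    (\<Sum>b<2 ^ e. E (xor a b) (xor a' b))" .
  show ?thesis
  proof (cases "a = a'")
    case False
    have anti: "E c' c = - E c c'" if "c \<noteq> c'" for c c'
    \<comment> \<open>The condition says that toggling \<open>c\<close> in \<open>S\<close> and
      \<open>c'\<close> in \<open>S'\<close> gives the same set. It is symmetric in \<open>c\<close>
      and \<open>c'\<close>, so otherwise both sides are zero.\<close>
    proof (cases "S' = toggle c' (toggle c S)")
      case True
      \<comment> \<open>As \<open>c\<close> and \<open>c'\<close> differ, membership of
        \<open>c'\<close> is opposite in \<open>S\<close> and \<open>S'\<close>, so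
        \<open>Y'\<close> at \<open>S'\<close> becomes \<open>Y\<close> at \<open>S\<close> with
        negated argument.\<close>
      have "G c c' = (\<Sum>u\<in>{0..<M}. Y c S (u - t) * Y c' S (t' - u))"
        using that unfolding G_def Y_def Y'_def True by (intro sum.cong) (auto simp: mem_toggle)
      \<comment> \<open>Replacing \<open>u\<close> by \<open>t + t' - u\<close> interchanges the two
        arguments: circulant matrices commute.\<close>
      also have "\<dots> = (\<Sum>u\<in>{0..<M}. Y c S (((t + t') - u) mod M - t) * Y c' S (t' - ((t + t') - u) mod M))"
        by (rule sum_mod_reflect[OF M, symmetric, where f = "\<lambda>u. Y c S (u - t) * Y c' S (t' - u)"])
      also have "\<dots> = (\<Sum>u\<in>{0..<M}. Y c S (t' - u) * Y c' S (u - t))"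
      proof -
        have "Y c S (((t + t') - u) mod M - t) = Y c S (t' - u)" for u
          unfolding Y_def by (simp add: mod_simps)
        moreover have "Y c' S (t' - ((t + t') - u) mod M) = Y c' S (u - t)" for u
          unfolding Y_def by (simp add: mod_simps)
        ultimately show ?thesis by simp
      qed
      also have "\<dots> = G c' c"
        using that unfolding G_def Y_def Y'_def True
        by (intro sum.cong) (auto simp: mem_toggle mult.commute)
      finally have "G c c' = G c' c" .
      moreover have "toggle c S = toggle c' S'" "toggle c' S = toggle c S'"
        by (simp_all add: True toggle_commute)
      \<comment> \<open>Only the sign belonging to the larger of \<open>c\<close> and
        \<open>c'\<close> changes between \<open>S\<close> and \<open>S'\<close>.\<close>
      moreover have "below_sign c' S * below_sign c S' = - (below_sign c S * below_sign c' S' :: 'a)"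
        using that by (auto simp: True below_sign_toggle)
      ultimately show ?thesis by (simp add: E_def)
    next
      case False
      then have "toggle c S \<noteq> toggle c' S'" "toggle c' S \<noteq> toggle c S'"
        by (metis toggle_toggle toggle_commute)+
      then show ?thesis by (simp add: E_def)
    qed
    define d where "d = xor a a'"
    have "d < 2 ^ e" using mem by (simp add: d_def xor_less_power2)
    \<comment> \<open>Translating the block column by \<open>d\<close> exchanges its labels in the
      two rows, so the whole sum equals its own negative.\<close>
    have sw: "xor a (xor b d) = xor a' b" "xor a' (xor b d) = xor a b" for b
      unfolding d_def by (metis xor.commute xor.assoc xor_cancel_left)+
    have "(\<Sum>b<2 ^ e. E (xor a b) (xor a' b)) = (\<Sum>b<2 ^ e. E (xor a (xor b d)) (xor a' (xor b d)))"
      by (rule sum.reindex_bij_witness[where i = "\<lambda>b. xor b d" and j = "\<lambda>b. xor b d"])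
        (use \<open>d < 2 ^ e\<close> in \<open>auto simp: xor.assoc xor_less_power2\<close>)
    also have "\<dots> = - (\<Sum>b<2 ^ e. E (xor a b) (xor a' b))"
      unfolding sw sum_negf[symmetric]
      by (intro sum.cong refl anti) (simp add: xor_left_eq_iff False)
    finally have "(\<Sum>b<2 ^ e. E (xor a b) (xor a' b)) = 0"
      by simp
    then show ?thesis using False unfolding total by (simp add: p_eq p'_eq)
  next
    case True
    show ?thesis
    proof (cases "S = S'")
      case False
      then show ?thesis using True unfolding total by (simp add: E_def p_eq p'_eq)
    next
      case S: True
      \<comment> \<open>Substituting \<open>w = t - u\<close> if \<open>c \<in> S\<close>, and
        \<open>w = u - t'\<close> otherwise, gives the same correlation, independent of
        \<open>S\<close>.\<close>
      have G: "G c c = (\<Sum>w\<in>{0..<M}. X c ((w + (t' - t)) mod M) * X' c w)" for c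
      proof (cases "c \<in> S")
        case True
        have "(\<Sum>w\<in>{0..<M}. X c ((w + (t' - t)) mod M) * X' c w) =
            (\<Sum>u\<in>{0..<M}. X c (((t - u) mod M + (t' - t)) mod M) * X' c ((t - u) mod M))"
          by (rule sum_mod_reflect[OF M, symmetric, where f = "\<lambda>w. X c ((w + (t' - t)) mod M) * X' c w"])
        also have "\<dots> = G c c"
          using True S unfolding G_def Y_def Y'_def
          by (intro sum.cong) (simp_all add: mod_simps mult.commute)
        finally show ?thesis by simp
      next
        case False
        have "(\<Sum>w\<in>{0..<M}. X c ((w + (t' - t)) mod M) * X' c w) =
            (\<Sum>u\<in>{0..<M}. X c (((u + - t') mod M + (t' - t)) mod M) * X' c ((u + - t') mod M))"
          by (rule sum_mod_shift[OF M, symmetric, where f = "\<lambda>w. X c ((w + (t' - t)) mod M) * X' c w"])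
        also have "\<dots> = G c c"
          using False S unfolding G_def Y_def Y'_def
          by (intro sum.cong) (simp_all add: mod_simps)
        finally show ?thesis by simp
      qed
      have "(\<Sum>b<2 ^ e. E (xor a b) (xor a' b)) = (\<Sum>b<2 ^ e. 2 ^ 2 ^ e * G (xor a b) (xor a b))"
        by (simp add: E_def True S)
      also have "\<dots> = (\<Sum>c<2 ^ e. 2 ^ 2 ^ e * G c c)"
        by (rule sum.reindex_bij_witness[where i = "xor a" and j = "xor a"])
          (use mem in \<open>auto simp: xor_less_power2\<close>)
      also have "\<dots> = 2 ^ 2 ^ e * (if (t' - t) mod M = 0 then f else 0)"
        unfolding G compl[symmetric] by (simp add: sum_distrib_left)
      also have "(t' - t) mod M = 0 \<longleftrightarrow> t = t'"
        using mem by (metis mod_pos_pos_trivial mod_eq_dvd_iff dvd_eq_mod_eq_0)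
      finally show ?thesis unfolding total by (simp add: p_eq p'_eq True S)
    qed
  qed
qed

section \<open>Monomial entries and the passage to a matrix\<close>

text \<open>Separates coefficient and variables, so that coefficients of equal monomials can be
  summed in the complex numbers.\<close>

lemma cterm_mult: "cterm u i * cterm v j = Poly_Mapping.single 0 (u * v) * (var i * var j)"
  by (simp add: cterm_def mult_single)

lemma map_cnj_cterm: "Poly_Mapping.map cnj (cterm u j) = cterm (cnj u) j"
  by (simp add: cterm_def)

text \<open>Frees the construction from numbering: one enumeration \<open>g\<close> of
  \<open>I\<close> serves for rows, columns and the summation index alike.\<close>

lemma is_COD_if_rows_orthogonal:
  fixes F :: "'b \<Rightarrow> 'b \<Rightarrow> cpoly"
  assumes I: "finite I" "card I = N"
    and pos: "\<And>c. c \<in> set cs \<Longrightarrow> c > 0"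
    and entries: "\<And>x y. x \<in> I \<Longrightarrow> y \<in> I \<Longrightarrow>
      F x y \<in> {cterm u j | u j. u \<in> {1, -1, \<i>, -\<i>} \<and> j < length cs}"
    and rows: "\<And>x y. x \<in> I \<Longrightarrow> y \<in> I \<Longrightarrow> (\<Sum>z\<in>I. F x z * Poly_Mapping.map cnj (F y z)) =
      (if x = y then (\<Sum>j<length cs. of_nat (cs ! j) * (var j)\<^sup>2) else 0)"
  shows "\<exists>X. is_COD N cs X"
proof -
  obtain g where g: "bij_betw g {0..<N} I"
    using ex_bij_betw_nat_finite[OF I(1)] I(2) by auto
  have gI: "g i \<in> I" if "i < N" for i
    using bij_betwE[OF g] that by auto
  define X where "X = mat N N (\<lambda>(i, j). F (g i) (g j))"
  have X: "X \<in> carrier_mat N N" by (simp add: X_def)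
  have "elements_mat X \<subseteq> {0} \<union> {cterm u j | u j. u \<in> {1, -1, \<i>, -\<i>} \<and> j < length cs}"
  proof
    fix x assume "x \<in> elements_mat X"
    then obtain i j where "i < N" "j < N" "x = F (g i) (g j)"
      by (auto simp: X_def elements_mat_def)
    then show "x \<in> {0} \<union> {cterm u j | u j. u \<in> {1, -1, \<i>, -\<i>} \<and> j < length cs}"
      using entries[OF gI gI, of i j] by blast
  qed
  moreover have "X * conj_transpose X = (\<Sum>j<length cs. of_nat (cs ! j) * (var j)\<^sup>2) \<cdot>\<^sub>m 1\<^sub>m N"
  proof (rule eq_matI)
    fix i j
    assume "i < dim_row ((\<Sum>j<length cs. of_nat (cs ! j) * (var j)\<^sup>2) \<cdot>\<^sub>m 1\<^sub>m N :: cpoly mat)"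
      "j < dim_col ((\<Sum>j<length cs. of_nat (cs ! j) * (var j)\<^sup>2) \<cdot>\<^sub>m 1\<^sub>m N :: cpoly mat)"
    then have ij: "i < N" "j < N" by simp_all
    have "(X * conj_transpose X) $$ (i, j) =
        (\<Sum>k\<in>{0..<N}. F (g i) (g k) * Poly_Mapping.map cnj (F (g j) (g k)))"
      using ij by (simp add: X_def conj_transpose_def scalar_prod_def)
    also have "\<dots> = (\<Sum>z\<in>I. F (g i) z * Poly_Mapping.map cnj (F (g j) z))"
      by (rule sum.reindex_bij_betw[OF g])
    also have "\<dots> = (if g i = g j then (\<Sum>j<length cs. of_nat (cs ! j) * (var j)\<^sup>2) else 0)"
      by (rule rows[OF gI gI]) (fact ij)+
    also have "g i = g j \<longleftrightarrow> i = j"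
      using ij bij_betw_imp_inj_on[OF g] by (auto simp: inj_on_def)
    finally show "(X * conj_transpose X) $$ (i, j) =
        ((\<Sum>j<length cs. of_nat (cs ! j) * (var j)\<^sup>2) \<cdot>\<^sub>m 1\<^sub>m N) $$ (i, j)"
      using ij by simp
  qed (simp_all add: X_def conj_transpose_def)
  ultimately show ?thesis
    unfolding is_COD_def using X pos by blast
qed

section \<open>Correlations of a Golay pair, sorted by lag\<close>

text \<open>The induction step adds a last row and column; their entries at distance
  \<open>d\<close> from the corner extend the two diagonals at lag \<open>d\<close>.\<close>

lemma sum_square_diagonals:
  fixes g :: "nat \<Rightarrow> nat \<Rightarrow> 'a :: comm_monoid_add"
  shows "(\<Sum>i<l. \<Sum>j<l. g i j) =
    (\<Sum>i<l. g i i) + (\<Sum>d\<in>{1..<l}. \<Sum>j<l - d. g (j + d) j + g j (j + d))"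
proof (induction l)
  case (Suc l)
  have "(\<Sum>d\<in>{1..<Suc l}. \<Sum>j<Suc l - d. g (j + d) j + g j (j + d)) =
      (\<Sum>d\<in>{1..<Suc l}. (\<Sum>j<l - d. g (j + d) j + g j (j + d)) + (g l (l - d) + g (l - d) l))"
    by (intro sum.cong) (auto simp: Suc_diff_le)
  also have "\<dots> = (\<Sum>d\<in>{1..<Suc l}. \<Sum>j<l - d. g (j + d) j + g j (j + d)) +
      (\<Sum>d\<in>{1..<Suc l}. g l (l - d) + g (l - d) l)"
    by (rule sum.distrib)
  also have "(\<Sum>d\<in>{1..<Suc l}. \<Sum>j<l - d. g (j + d) j + g j (j + d)) =
      (\<Sum>d\<in>{1..<l}. \<Sum>j<l - d. g (j + d) j + g j (j + d))"
    by (cases l) simp_all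
  also have "(\<Sum>d\<in>{1..<Suc l}. g l (l - d) + g (l - d) l) = (\<Sum>j<l. g l j + g j l)"
    by (rule sum.reindex_bij_witness[where i = "\<lambda>j. l - j" and j = "\<lambda>d. l - d"]) auto
  finally show ?case
    using Suc.IH by (simp add: sum.distrib algebra_simps)
qed simp

text \<open>Nonzero lags vanish, positive ones by complementarity and negative ones by conjugation.
  The filter \<open>Q\<close> is arbitrary so that it can later select a residue class of
  lags.\<close>

lemma complementary_filtered_correlation:
  fixes Q :: "int \<Rightarrow> bool"
  assumes "length A = l" "length B = l" "complementary A B"
    and unit: "\<And>z. z \<in> set A \<union> set B \<Longrightarrow> z * cnj z = 1"
  shows "(\<Sum>i<l. \<Sum>j<l. if Q (int i - int j) then A ! i * cnj (A ! j) + B ! i * cnj (B ! j) else 0) =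
    (if Q 0 then of_nat (2 * l) else 0)"
proof -
  define c where "c i j = A ! i * cnj (A ! j) + B ! i * cnj (B ! j)" for i j
  have lag: "(\<Sum>j<l - d. c (j + d) j) = 0" if "d > 0" for d
    using assms that by (simp add: c_def complementary_def autocorr_def sum.distrib)
  have "(\<Sum>j<l - d. c j (j + d)) = cnj (\<Sum>j<l - d. c (j + d) j)" for d
    by (simp add: c_def mult.commute)
  with lag have lag': "(\<Sum>j<l - d. c j (j + d)) = 0" if "d > 0" for d
    using that by (metis complex_cnj_zero)
  have diag: "c i i = 2" if "i < l" for i
    using that assms unit[of "A ! i"] unit[of "B ! i"] by (simp add: c_def)
  have pull: "(\<Sum>j\<in>T. if R then f j else 0) = (if R then sum f T else 0)"
    for R and f :: "nat \<Rightarrow> complex" and T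
    by simp
  have "(\<Sum>i<l. \<Sum>j<l. if Q (int i - int j) then c i j else 0) =
      (\<Sum>i<l. if Q 0 then c i i else 0) + (\<Sum>d\<in>{1..<l}.
        (if Q (int d) then \<Sum>j<l - d. c (j + d) j else 0) +
        (if Q (- int d) then \<Sum>j<l - d. c j (j + d) else 0))"
    unfolding sum_square_diagonals by (simp add: sum.distrib pull)
  also have "\<dots> = (if Q 0 then of_nat (2 * l) else 0)"
    by (subst (2) sum.neutral) (auto simp: lag lag' diag)
  finally show ?thesis unfolding c_def .
qed

section \<open>Concatenating blocks into complementary sequences\<close>

lemma sum_blocks:
  fixes l :: "nat \<Rightarrow> nat" and g :: "nat \<Rightarrow> 'a :: comm_monoid_add"
  shows "(\<Sum>t<(\<Sum>v<P. l v). g t) = (\<Sum>v<P. \<Sum>i<l v. g ((\<Sum>w<v. l w) + i))"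
proof (induction P)
  case (Suc P)
  have "(\<Sum>t<a + b. g t) = (\<Sum>t<a. g t) + (\<Sum>i<b. g (a + i))" for a b :: nat
    by (induction b) (simp_all add: add.assoc)
  with Suc.IH show ?case by simp
qed simp

text \<open>\<open>blk t\<close> is the least block ending after \<open>t\<close>, which also copes
  with empty blocks. Since \<open>l\<close> is an infinite sequence, one pair of maps serves every
  \<open>P\<close>.\<close>

lemma exists_block_coordinates:
  fixes l :: "nat \<Rightarrow> nat"
  shows "\<exists>blk off. (\<forall>v i. i < l v \<longrightarrow> blk ((\<Sum>w<v. l w) + i) = v \<and> off ((\<Sum>w<v. l w) + i) = i) \<and>
    (\<forall>P. \<forall>t<(\<Sum>v<P. l v). blk t < P \<and> off t < l (blk t))"
proof -
  define s where "s v = (\<Sum>w<v. l w)" for v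
  have s_Suc: "s (Suc v) = s v + l v" for v
    by (simp add: s_def)
  have mono: "s u \<le> s v" if "u \<le> v" for u v
    unfolding s_def using that by (intro sum_mono2) auto
  define blk where "blk t = (LEAST v. t < s (Suc v))" for t
  have blk_eq: "blk (s v + i) = v" if "i < l v" for v i
    unfolding blk_def
  proof (rule Least_equality)
    show "s v + i < s (Suc v)" using that by (simp add: s_Suc)
    show "v \<le> u" if "s v + i < s (Suc u)" for u
      using mono[of "Suc u" v] that by (cases "v \<le> u") auto
  qed
  have "blk t < P \<and> t - s (blk t) < l (blk t)" if "t < s P" for P t
    using that
  proof (induction P)
    case (Suc P)
    show ?case
    proof (cases "t < s P")
      case False
      with Suc.prems blk_eq[of "t - s P" P] show ?thesis by (simp add: s_Suc)
    qed (use Suc.IH in auto)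
  qed (simp add: s_def)
  with blk_eq have "(\<forall>v i. i < l v \<longrightarrow> blk (s v + i) = v \<and> s v + i - s (blk (s v + i)) = i) \<and>
      (\<forall>P. \<forall>t<s P. blk t < P \<and> t - s (blk t) < l (blk t))"
    by simp
  then show ?thesis
    unfolding s_def by (intro exI[of _ blk] exI[of _ "\<lambda>t. t - s (blk t)"]) (auto simp: s_def)
qed

lemma sum_double: "(\<Sum>c<2 * P. g c) = (\<Sum>h<P. g (2 * h) + g (2 * h + 1))"
  for g :: "nat \<Rightarrow> 'a :: comm_monoid_add"
  by (induction P) (simp_all add: add.assoc)

lemma single_sum: "Poly_Mapping.single k (\<Sum>x\<in>A. f x) = (\<Sum>x\<in>A. Poly_Mapping.single k (f x))"
  by (induction A rule: infinite_finite_induct) (simp_all add: single_add)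

lemma sum_int_range: "(\<Sum>x\<in>{0..<int M}. f x) = (\<Sum>x<M. f (int x))"
  by (rule sum.reindex_bij_witness[where i = int and j = nat]) auto

lemma mult_closed_fourth_roots:
  "u \<in> {1, -1} \<Longrightarrow> z \<in> {1, -1, \<i>, -\<i>} \<Longrightarrow> u * z \<in> {1, -1, \<i>, -\<i> :: complex}"
  by auto

text \<open>Sylvester orthogonality removes correlations between distinct blocks, the Golay property
  those within a block, even cyclically. The variable \<open>y t\<close> depends on the position
  alone, and \<open>w\<close> lets several blocks share a variable.\<close>

lemma exists_complementary_family:
  fixes l w :: "nat \<Rightarrow> nat" and A B :: "nat \<Rightarrow> complex list"
  assumes golay: "\<And>v. v < 2 ^ e \<Longrightarrow> complex_golay_pair (l v) (A v) (B v)"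
    and M: "M = (\<Sum>v<2 ^ e. l v)" "M > 0"
  shows "\<exists>(\<xi> :: nat \<Rightarrow> int \<Rightarrow> complex) (y :: int \<Rightarrow> nat).
    (\<forall>c. \<forall>t\<in>{0..<int M}. \<xi> c t \<in> {1, -1, \<i>, -\<i>} \<and> y t \<in> w ` {..<2 ^ e}) \<and>
    (\<forall>s. (\<Sum>c<2 ^ Suc e. \<Sum>x\<in>{0..<int M}.
        cterm (\<xi> c ((x + s) mod int M)) (y ((x + s) mod int M)) * cterm (cnj (\<xi> c x)) (y x)) =
      (if s mod int M = 0 then 2 ^ Suc e * (\<Sum>v<2 ^ e. of_nat (l v) * (var (w v))\<^sup>2) else 0))"
proof -
  define pos where "pos v = (\<Sum>u<v. l u)" for v
  obtain blk off where
    blk: "\<And>v i. i < l v \<Longrightarrow> blk (pos v + i) = v" "\<And>v i. i < l v \<Longrightarrow> off (pos v + i) = i"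
    and blk_less: "\<And>P t. t < (\<Sum>v<P. l v) \<Longrightarrow> blk t < P" "\<And>P t. t < (\<Sum>v<P. l v) \<Longrightarrow> off t < l (blk t)"
    unfolding pos_def using exists_block_coordinates[of l] by blast
  obtain H :: "nat \<Rightarrow> nat \<Rightarrow> complex" where H: "\<And>h v. H h v \<in> {1, -1}"
    and H_orth: "\<And>v w. v < 2 ^ e \<Longrightarrow> w < 2 ^ e \<Longrightarrow>
      (\<Sum>h<2 ^ e. H h v * H h w) = (if v = w then 2 ^ e else 0)"
    using exists_hadamard_signs[of e] by blast
  have cnj_H: "cnj (H h v) = H h v" for h v
    using H[of h v] by auto
  define C where "C c v = (if even c then A v else B v)" for c :: nat and v
  have C_unit: "C c v ! i \<in> {1, -1, \<i>, -\<i>}" if "v < 2 ^ e" "i < l v" for c v i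
  proof -
    have "i < length (C c v)" "set (C c v) \<subseteq> {1, -1, \<i>, -\<i>}"
      using golay[OF that(1)] that(2) by (simp_all add: complex_golay_pair_def C_def)
    then show ?thesis using nth_mem by blast
  qed
  \<comment> \<open>Sequences \<open>2 * h\<close> and \<open>2 * h + 1\<close> use the same
    Sylvester row \<open>h\<close>, the even one with the \<open>A v\<close> and the odd one with
    the \<open>B v\<close>.\<close>
  define \<xi> where "\<xi> c t = H (c div 2) (blk (nat t)) * C c (blk (nat t)) ! off (nat t)" for c t
  define y where "y t = w (blk (nat t))" for t
  let ?S = "Poly_Mapping.single 0 :: complex \<Rightarrow> cpoly"

  have corr: "(\<Sum>c<2 ^ Suc e. \<xi> c (int (pos v + i)) * cnj (\<xi> c (int (pos v' + i')))) =
      (if v' = v then 2 ^ e * (A v ! i * cnj (A v ! i') + B v ! i * cnj (B v ! i')) else 0)"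
    if "v < 2 ^ e" "v' < 2 ^ e" "i < l v" "i' < l v'" for v v' i i'
  proof -
    have "(\<Sum>c<2 ^ Suc e. \<xi> c (int (pos v + i)) * cnj (\<xi> c (int (pos v' + i')))) =
        (\<Sum>h<2 ^ e. H h v * H h v') *
        (A v ! i * cnj (A v' ! i') + B v ! i * cnj (B v' ! i'))"
      unfolding power_Suc sum_double sum_distrib_right
      using that by (intro sum.cong) (simp_all add: \<xi>_def C_def blk cnj_H del: of_nat_add,
          simp_all add: algebra_simps)
    then show ?thesis using H_orth[OF that(1,2)] by simp
  qed
  have "(\<Sum>c<2 ^ Suc e. \<Sum>x\<in>{0..<int M}.
      cterm (\<xi> c ((x + s) mod int M)) (y ((x + s) mod int M)) * cterm (cnj (\<xi> c x)) (y x)) =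
    (if s mod int M = 0 then 2 ^ Suc e * (\<Sum>v<2 ^ e. of_nat (l v) * (var (w v))\<^sup>2) else 0)"
    (is "?lhs = ?rhs") for s
  proof -
    \<comment> \<open>Instead of reducing \<open>x + s\<close> modulo \<open>M\<close>, let
      \<open>t\<close> run over all positions under a divisibility condition; the double sum then
      splits into blocks.\<close>
    define Z where "Z t x = (if int M dvd t - x - s
      then ?S (\<Sum>c<2 ^ Suc e. \<xi> c t * cnj (\<xi> c x)) * (var (y t) * var (y x)) else 0)" for t x
    have "?lhs = (\<Sum>x\<in>{0..<int M}. \<Sum>c<2 ^ Suc e.
        ?S (\<xi> c ((x + s) mod int M) * cnj (\<xi> c x)) * (var (y ((x + s) mod int M)) * var (y x)))"
      by (subst sum.swap, intro sum.cong refl) (rule cterm_mult)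
    also have "\<dots> = (\<Sum>x\<in>{0..<int M}. \<Sum>t\<in>{0..<int M}. Z t x)"
    proof (rule sum.cong[OF refl])
      fix x
      let ?t = "(x + s) mod int M"
      have "int M dvd t - x - s \<longleftrightarrow> t = ?t" if "t \<in> {0..<int M}" for t
        using that by (metis atLeastLessThan_iff diff_diff_eq mod_eq_dvd_iff mod_pos_pos_trivial)
      then have "(\<Sum>t\<in>{0..<int M}. Z t x) = (\<Sum>t\<in>{0..<int M}. if t = ?t
          then ?S (\<Sum>c<2 ^ Suc e. \<xi> c t * cnj (\<xi> c x)) * (var (y t) * var (y x)) else 0)"
        unfolding Z_def by (intro sum.cong) auto
      also have "\<dots> = (\<Sum>c<2 ^ Suc e. ?S (\<xi> c ?t * cnj (\<xi> c x)) * (var (y ?t) * var (y x)))"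
        using M(2) by (simp add: single_sum sum_distrib_right del: power_Suc)
      finally show "(\<Sum>c<2 ^ Suc e. ?S (\<xi> c ?t * cnj (\<xi> c x)) * (var (y ?t) * var (y x))) =
        (\<Sum>t\<in>{0..<int M}. Z t x)" by simp
    qed
    also have "\<dots> = (\<Sum>t\<in>{0..<int M}. \<Sum>x\<in>{0..<int M}. Z t x)"
      by (rule sum.swap)
    also have "\<dots> = (\<Sum>v<2 ^ e. \<Sum>i<l v. \<Sum>v'<2 ^ e. \<Sum>i'<l v'.
        Z (int (pos v + i)) (int (pos v' + i')))"
      unfolding sum_int_range M(1) sum_blocks pos_def ..
    \<comment> \<open>By \<open>corr\<close> only pairs of positions in one block survive, and their
      common start \<open>pos v\<close> cancels in the difference.\<close>
    also have "\<dots> = (\<Sum>v<2 ^ e. \<Sum>i<l v. \<Sum>i'<l v. ?S (2 ^ e *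
        (if int M dvd int i - int i' - s
         then A v ! i * cnj (A v ! i') + B v ! i * cnj (B v ! i') else 0)) * (var (w v))\<^sup>2)"
    proof (rule sum.cong[OF refl], rule sum.cong[OF refl])
      fix v i assume "v \<in> {..<2 ^ e :: nat}" "i \<in> {..<l v}"
      then have vi: "v < 2 ^ e" "i < l v" by simp_all
      let ?R = "\<lambda>i'. ?S (2 ^ e * (if int M dvd int i - int i' - s
         then A v ! i * cnj (A v ! i') + B v ! i * cnj (B v ! i') else 0)) * (var (w v))\<^sup>2"
      have "(\<Sum>i'<l v'. Z (int (pos v + i)) (int (pos v' + i'))) =
          (if v' = v then \<Sum>i'<l v. ?R i' else 0)" if "v' < 2 ^ e" for v'
      proof -
        have "Z (int (pos v + i)) (int (pos v' + i')) = (if v' = v then ?R i' else 0)"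
          if "i' < l v'" for i'
        proof -
          have "y (int (pos v + i)) = w v" "y (int (pos v' + i')) = w v'"
            using vi that by (simp_all add: y_def blk del: of_nat_add)
          then show ?thesis
            unfolding Z_def corr[OF vi(1) \<open>v' < 2 ^ e\<close> vi(2) that]
            by (auto simp: power2_eq_square)
        qed
        then show ?thesis by simp
      qed
      then have "(\<Sum>v'<2 ^ e. \<Sum>i'<l v'. Z (int (pos v + i)) (int (pos v' + i'))) =
          (\<Sum>v'<2 ^ e. if v' = v then \<Sum>i'<l v. ?R i' else 0)"
        by (intro sum.cong) auto
      also have "\<dots> = (\<Sum>i'<l v. ?R i')"
        using vi by simp
      finally show "(\<Sum>v'<2 ^ e. \<Sum>i'<l v'. Z (int (pos v + i)) (int (pos v' + i'))) =
        (\<Sum>i'<l v. ?R i')" .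
    qed
    also have "\<dots> = (\<Sum>v<2 ^ e. ?S (2 ^ e * (\<Sum>i<l v. \<Sum>i'<l v.
        if int M dvd int i - int i' - s
        then A v ! i * cnj (A v ! i') + B v ! i * cnj (B v ! i') else 0)) * (var (w v))\<^sup>2)"
      by (simp only: single_sum sum_distrib_left sum_distrib_right)
    \<comment> \<open>The filter selects lags congruent to \<open>s\<close> modulo \<open>M\<close>.
      Lag 0 is among them exactly when \<open>M\<close> divides \<open>s\<close>, and contributes
      \<open>l v\<close> from each member of the pair.\<close>
    also have "\<dots> = (\<Sum>v<2 ^ e. ?S (2 ^ e * (if int M dvd 0 - s then of_nat (2 * l v) else 0)) *
        (var (w v))\<^sup>2)"
    proof (intro sum.cong refl)
      fix v assume "v \<in> {..<2 ^ e :: nat}"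
      then have g: "complex_golay_pair (l v) (A v) (B v)" using golay by simp
      have unit: "z * cnj z = 1" if "z \<in> set (A v) \<union> set (B v)" for z
      proof -
        have "z \<in> {1, -1, \<i>, -\<i>}" using g that unfolding complex_golay_pair_def by blast
        then show ?thesis by auto
      qed
      show "?S (2 ^ e * (\<Sum>i<l v. \<Sum>i'<l v. if int M dvd int i - int i' - s
          then A v ! i * cnj (A v ! i') + B v ! i * cnj (B v ! i') else 0)) * (var (w v))\<^sup>2 =
        ?S (2 ^ e * (if int M dvd 0 - s then of_nat (2 * l v) else 0)) * (var (w v))\<^sup>2"
        using g complementary_filtered_correlation[of "A v" "l v" "B v" "\<lambda>d. int M dvd d - s"] unit
        unfolding complex_golay_pair_def by simp
    qed
    also have "\<dots> = ?rhs"
    proof (cases "s mod int M = 0")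
      case True
      have "?S (2 ^ e * of_nat (2 * k)) = 2 ^ Suc e * of_nat k" for k
      proof -
        have "?S (of_nat (2 ^ e * (2 * k))) = of_nat (2 ^ e * (2 * k))"
          by (rule single_of_nat)
        then show ?thesis by (simp add: algebra_simps)
      qed
      with True show ?thesis
        by (simp add: dvd_eq_mod_eq_0[symmetric] sum_distrib_left mult.assoc del: power_Suc of_nat_mult)
    qed (simp add: dvd_eq_mod_eq_0[symmetric])
    finally show ?thesis .
  qed
  moreover have "\<xi> c t \<in> {1, -1, \<i>, -\<i>} \<and> y t \<in> w ` {..<2 ^ e}" if "t \<in> {0..<int M}" for c t
  proof -
    have "nat t < (\<Sum>v<2 ^ e. l v)" using that unfolding M(1)[symmetric] by auto
    note less = blk_less[OF this]
    show ?thesis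
      using less mult_closed_fourth_roots[OF H C_unit[OF less]] by (auto simp: \<xi>_def y_def)
  qed
  ultimately show ?thesis by (intro exI[of _ \<xi>] exI[of _ y]) blast
qed

section \<open>Designs from a list of Golay pairs\<close>

text \<open>Two sequences per Sylvester row make \<open>2 ^ Suc e\<close> of them, so the block
  design is used with \<open>Suc e\<close>. Of the factor in \<open>weights\<close>,
  \<open>2 ^ Suc e\<close> comes from complementarity and \<open>2 ^ 2 ^ Suc e\<close> from the
  Sylvester matrix that fills the zeros.\<close>

lemma exists_COD_of_golay_pairs:
  fixes l w :: "nat \<Rightarrow> nat" and A B :: "nat \<Rightarrow> complex list"
  assumes golay: "\<And>v. v < 2 ^ e \<Longrightarrow> complex_golay_pair (l v) (A v) (B v)"
    and M: "M = (\<Sum>v<2 ^ e. l v)" "M > 0"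
    and w: "\<And>v. v < 2 ^ e \<Longrightarrow> w v < length cs"
    and pos: "\<And>c. c \<in> set cs \<Longrightarrow> c > 0"
    and weights: "(\<Sum>j<length cs. of_nat (cs ! j) * (var j)\<^sup>2) =
      2 ^ (2 ^ Suc e + Suc e) * (\<Sum>v<2 ^ e. of_nat (l v) * (var (w v))\<^sup>2)"
  shows "\<exists>X. is_COD (2 ^ (2 ^ Suc e + Suc e) * M) cs X"
proof -
  obtain \<xi> :: "nat \<Rightarrow> int \<Rightarrow> complex" and y :: "int \<Rightarrow> nat" where
    \<xi>: "\<And>c t. t \<in> {0..<int M} \<Longrightarrow> \<xi> c t \<in> {1, -1, \<i>, -\<i>}"
    and y: "\<And>t. t \<in> {0..<int M} \<Longrightarrow> y t \<in> w ` {..<2 ^ e}"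
    and compl: "\<And>s. (\<Sum>c<2 ^ Suc e. \<Sum>x\<in>{0..<int M}.
        cterm (\<xi> c ((x + s) mod int M)) (y ((x + s) mod int M)) * cterm (cnj (\<xi> c x)) (y x)) =
      (if s mod int M = 0 then 2 ^ Suc e * (\<Sum>v<2 ^ e. of_nat (l v) * (var (w v))\<^sup>2) else 0)"
    using exists_complementary_family[where w = w, OF golay M] by blast
  define X where "X c t = cterm (\<xi> c t) (y t)" for c t
  define X' where "X' c t = cterm (cnj (\<xi> c t)) (y t)" for c t
  have neg: "- cterm u j = cterm (- u) j" for u j
    by (simp add: cterm_def single_uminus)
  define ev where "ev a b S U \<longleftrightarrow> even (card (S \<inter> {..<xor a b}) + card (toggle (xor a b) S \<inter> U))"
    for a b :: nat and S U
  \<comment> \<open>Kept general in \<open>f\<close> and \<open>f'\<close> because both orders of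
    \<open>X\<close> and \<open>X'\<close> are needed: conjugating an entry exchanges them.\<close>
  have entry: "design_entry (int M) (\<lambda>c t. cterm (f c t) (y t)) (\<lambda>c t. cterm (f' c t) (y t)) (a, S, t) (b, U, u) =
     (let v = (if xor a b \<in> S then f' (xor a b) ((t - u) mod int M) else f (xor a b) ((u - t) mod int M));
          x = (if xor a b \<in> S then y ((t - u) mod int M) else y ((u - t) mod int M))
      in cterm (if ev a b S U then v else - v) x)" for f f' a S t b U u
    by (simp add: design_entry_def below_sign_def ev_def neg minus_one_power_iff Let_def flip: power_add)
  have cnj_entry: "Poly_Mapping.map cnj (design_entry (int M) X X' p z) = design_entry (int M) X' X p z" for p z
    unfolding X_def X'_def by (cases p; cases z) (simp add: entry Let_def map_cnj_cterm)
  show ?thesis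
  proof (rule is_COD_if_rows_orthogonal[where F = "design_entry (int M) X X'"])
    show "finite (design_index (Suc e) (int M))"
      by (rule finite_design_index)
    show "card (design_index (Suc e) (int M)) = 2 ^ (2 ^ Suc e + Suc e) * M"
      by (subst card_design_index) simp_all
    show "c > 0" if "c \<in> set cs" for c using pos that .
  next
    fix p z
    assume "p \<in> design_index (Suc e) (int M)" "z \<in> design_index (Suc e) (int M)"
    obtain a S t b U u where pz: "p = (a, S, t)" "z = (b, U, u)" by (cases p; cases z)
    define r where "r = (if xor a b \<in> S then (t - u) mod int M else (u - t) mod int M)"
    define v where "v = (if xor a b \<in> S then cnj (\<xi> (xor a b) r) else \<xi> (xor a b) r)"
    have r: "r \<in> {0..<int M}" using M(2) by (simp add: r_def)
    have "v \<in> {1, -1, \<i>, -\<i>}" using \<xi>[OF r, of "xor a b"] unfolding v_def by auto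
    then have "(if ev a b S U then v else - v) \<in> {1, -1, \<i>, -\<i>}" by auto
    moreover have "y r < length cs" using y[OF r] w by auto
    moreover have "design_entry (int M) X X' p z = cterm (if ev a b S U then v else - v) (y r)"
      unfolding X_def X'_def pz entry Let_def v_def r_def by simp
    ultimately show "design_entry (int M) X X' p z \<in>
      {cterm u j | u j. u \<in> {1, -1, \<i>, -\<i>} \<and> j < length cs}" by blast
  next
    fix p z
    assume pz: "p \<in> design_index (Suc e) (int M)" "z \<in> design_index (Suc e) (int M)"
    have "(\<Sum>x\<in>design_index (Suc e) (int M). design_entry (int M) X X' p x * design_entry (int M) X' X z x) =
      (if p = z then 2 ^ 2 ^ Suc e * (2 ^ Suc e * (\<Sum>v<2 ^ e. of_nat (l v) * (var (w v))\<^sup>2)) else 0)"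
      by (rule design_rows_orthogonal[OF _ _ pz]) (use M(2) compl in \<open>simp_all add: X_def X'_def\<close>)
    then show "(\<Sum>x\<in>design_index (Suc e) (int M). design_entry (int M) X X' p x *
        Poly_Mapping.map cnj (design_entry (int M) X X' z x)) =
      (if p = z then (\<Sum>j<length cs. of_nat (cs ! j) * (var j)\<^sup>2) else 0)"
      unfolding cnj_entry weights by (simp add: power_add mult.assoc)
  qed
qed

section \<open>Block lengths and weights of the stated design\<close>

lemma golay_number_imp_complex_golay_number: "golay_number r \<Longrightarrow> complex_golay_number r"
  unfolding golay_number_def complex_golay_number_def golay_pair_def complex_golay_pair_def by blast

text \<open>A sequence of length 1 has no positive lag; such a pair fills the block of the first
  variable.\<close>

lemma complex_golay_number_1: "complex_golay_number 1"
  unfolding complex_golay_number_def complex_golay_pair_def complementary_def autocorr_def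
  by (auto intro!: exI[of _ "[1]"])

theorem theorem17:
  fixes n r m q :: nat and k :: "nat \<Rightarrow> nat"
  assumes "n > 2"
    and "golay_number r"
    and "\<And>j. j \<in> {1..2 ^ (n - 3) - 1} \<Longrightarrow> complex_golay_number (k j)"
    and "m = 2 * (\<Sum>j = 1..2 ^ (n - 3) - 1. k j) + r + 1"
    and "q = 2 ^ (n - 1) + n - 1"
  shows "\<exists>X. is_COD (2 ^ q * m)
    ([2 ^ q, 2 ^ q * r] @ map (\<lambda>j. 2 ^ (q + 1) * k j) [1..<2 ^ (n - 3)]) X"
proof -
  \<comment> \<open>There are \<open>2 * P\<close> blocks: one for each of the first two variables
    and two for each of the other \<open>P - 1\<close>.\<close>
  define P :: nat where "P = 2 ^ (n - 3)"
  define e where "e = n - 2"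
  have P: "P \<ge> 1" "(2::nat) ^ e = 2 * P" and q: "q = 2 ^ Suc e + Suc e"
    using assms(1,5) by (auto simp: P_def e_def Suc_diff_Suc numeral_2_eq_2 numeral_3_eq_3 simp flip: power_Suc)
  have range: "{1..2 ^ (n - 3) - 1} = {1..<P}"
    by (auto simp: P_def)
  define l where "l v = (if v = 0 then 1 else if v = 1 then r else k (v div 2))" for v
  \<comment> \<open>For \<open>j \<ge> 1\<close>, blocks \<open>2 * j\<close> and
    \<open>2 * j + 1\<close> carry variable \<open>j + 1\<close>: variables 0 and 1 are taken and
    \<open>j\<close> starts at 1.\<close>
  define w where "w v = (if v < 2 then v else v div 2 + 1)" for v :: nat
  define cs where "cs = [2 ^ q, 2 ^ q * r] @ map (\<lambda>j. 2 ^ (q + 1) * k j) [1..<P]"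
  have l_golay: "complex_golay_number (l v)" if "v < 2 * P" for v
    using that assms(3)[of "v div 2", unfolded range] golay_number_imp_complex_golay_number[OF assms(2)]
      complex_golay_number_1
    by (auto simp: l_def less_mult_imp_div_less mult.commute)
  then have "\<exists>A B. complex_golay_pair (l v) A B" if "v < 2 * P" for v
    using that unfolding complex_golay_number_def by blast
  then obtain A B where AB: "\<And>v. v < 2 * P \<Longrightarrow> complex_golay_pair (l v) (A v) (B v)"
    by metis
  have split_first: "(\<Sum>v<2 * P. g v) = g 0 + g 1 + (\<Sum>j = 1..<P. g (2 * j) + g (2 * j + 1))"
    for g :: "nat \<Rightarrow> 'z :: comm_monoid_add"
    using P(1) unfolding sum_double by (simp add: lessThan_atLeast0 sum.atLeast_Suc_lessThan)
  have len: "length cs = P + 1" using P(1) by (simp add: cs_def)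
  have m: "m = (\<Sum>v<2 ^ e. l v)"
    unfolding P(2) split_first assms(4) range
    by (simp add: l_def sum_distrib_left mult_2)
  have "\<exists>X. is_COD (2 ^ (2 ^ Suc e + Suc e) * m) cs X"
  proof (rule exists_COD_of_golay_pairs[where l = l and w = w, OF _ m])
    show "m > 0" using assms(4) by simp
    show "complex_golay_pair (l v) (A v) (B v)" if "v < 2 ^ e" for v
      using that AB by (simp add: P(2))
    show "w v < length cs" if "v < 2 ^ e" for v
      using that P(1) unfolding P(2) w_def len by auto
    show "c > 0" if "c \<in> set cs" for c
      using that assms(2) assms(3)[unfolded range]
      by (auto simp: cs_def golay_number_def complex_golay_number_def)
    have "(\<Sum>j<length cs. of_nat (cs ! j) * (var j)\<^sup>2) =
        of_nat (cs ! 0) * (var 0)\<^sup>2 + (of_nat (cs ! 1) * (var 1)\<^sup>2 +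
        (\<Sum>j = 1..<P. of_nat (cs ! (j + 1)) * (var (j + 1))\<^sup>2))"
      using P(1) unfolding len Suc_eq_plus1[symmetric] sum.lessThan_Suc_shift
      by (simp add: lessThan_atLeast0 sum.atLeast_Suc_lessThan)
    also have "\<dots> = 2 ^ q * (\<Sum>v<2 * P. of_nat (l v) * (var (w v))\<^sup>2)"
    proof -
      have "cs ! (j + 1) = 2 ^ (q + 1) * k j" if "j \<in> {1..<P}" for j
        using that by (cases j) (auto simp: cs_def)
      \<comment> \<open>The two blocks of length \<open>k j\<close> sharing a variable account for
        the additional factor 2 in \<open>2 ^ (q + 1) * k j\<close>.\<close>
      then have "(\<Sum>j = 1..<P. of_nat (cs ! (j + 1)) * (var (j + 1))\<^sup>2) =
          2 ^ q * (\<Sum>j = 1..<P. of_nat (l (2 * j)) * (var (w (2 * j)))\<^sup>2 +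
            of_nat (l (2 * j + 1)) * (var (w (2 * j + 1)))\<^sup>2)"
        unfolding sum_distrib_left
        by (intro sum.cong) (simp_all add: l_def w_def algebra_simps)
      then show ?thesis
        unfolding split_first by (simp add: cs_def l_def w_def algebra_simps)
    qed
    finally show "(\<Sum>j<length cs. of_nat (cs ! j) * (var j)\<^sup>2) =
        2 ^ (2 ^ Suc e + Suc e) * (\<Sum>v<2 ^ e. of_nat (l v) * (var (w v))\<^sup>2)"
      unfolding q P(2) .
  qed
  then show ?thesis
    unfolding cs_def q[symmetric] P_def .
qed

end
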